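(* For a (Tychonoff) topological space $X$ consider the following condition: $( * )$ $X$ is (homeomorphic to) a dense subspace of the limit space $\lim\mathcal S$ of an open $\omega$-spectrum $\mathcal S=\{X_\alpha,\pi_\alpha^\gamma,A\}$ such that for every $\alpha\in A$ the restriction $\pi_\alpha|X:X\to X_\alpha$ of the limit projection $\pi_\alpha:\lim\mathcal S\to X_\alpha$ is open and surjective. Then: (1) if $X$ is openly factorizable, then $X$ satisfies $( * )$; (2) if $X$ is weakly Lindelöf, then $X$ is openly factorizable if and only if $X$ satisfies $( * )$.
   Context: All topological spaces are assumed to be Tychonoff. A space $X$ is openly factorizable if for each continuous map $f:X\to Y$ to a second countable space $Y$ there are a continuous open map $p:X\to Z$ onto a second countable space $Z$ and a continuous map $g:Z\to Y$ such that $f=g\circ p$. A space $X$ is weakly Lindelöf if each open cover $\mathcal U$ of $X$ contains a countable subcollection $\mathcal V\subset\mathcal U$ whose union is dense in $X$. A partially ordered set $A$ is directed if any two elements have a common upper bound in $A$, and $\omega$-directed if each countable subset of $A$ has an upper bound in $A$. A spectrum over a directed set $(A,\le)$ is a collection $\mathcal S=\{X_\alpha,\pi_\alpha^\gamma,A\}$ of Tychonoff spaces $X_\alpha$, $\alpha\in A$, and continuous surjective maps $\pi_\alpha^\gamma:X_\gamma\to X_\alpha$ for $\alpha\le\gamma$ in $A$, such that $\pi_\alpha^\gamma=\pi_\alpha^\beta\circ\pi_\beta^\gamma$ for all $\alpha\le\beta\le\gamma$ in $A$. Its limit is the subspace $\lim\mathcal S=\{(x_\alpha)_{\alpha\in A}\in\prod_{\alpha\in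 A}X_\alpha: x_\alpha=\pi_\alpha^\beta(x_\beta)\text{ for all }\alpha\le\beta\}$ of the product, and the limit projections $\pi_\alpha:\lim\mathcal S\to X_\alpha$ are the coordinate projections. The spectrum is open if all maps $\pi_\alpha^\gamma$, $\alpha\le\gamma$, are open and surjective; it is an $\omega$-spectrum if $A$ is $\omega$-directed and each $X_\alpha$ is second countable. *)

theory Defs
  imports "HOL-Analysis.Analysis"
begin

section \<open>Openly factorizable and weakly Lindelof spaces\<close>

definition tychonoff_space :: "'a topology \<Rightarrow> bool" where
  "tychonoff_space X \<longleftrightarrow> completely_regular_space X \<and> Hausdorff_space X"

definition open_factorization ::
  "'a topology \<Rightarrow> 'y topology \<Rightarrow> ('a \<Rightarrow> 'y) \<Rightarrow> 'z topology \<Rightarrow> ('a \<Rightarrow> 'z) \<Rightarrow> ('z \<Rightarrow> 'y) \<Rightarrow> bool" where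
  "open_factorization X Y f Z p g \<longleftrightarrow>
     tychonoff_space Z \<and> second_countable Z \<and>
     continuous_map X Z p \<and> open_map X Z p \<and> p ` topspace X = topspace Z \<and>
     continuous_map Z Y g \<and> (\<forall>x\<in>topspace X. f x = g (p x))"

text \<open>HOL cannot quantify over types inside a formula, so the second countable spaces \<open>Y\<close> and
  \<open>Z\<close> are taken with carriers in the type \<^typ>\<open>nat \<Rightarrow> real\<close> (and an arbitrary topology).
  Every second countable Hausdorff space is homeomorphic to such a space, so nothing is lost:
  see \<open>openly_factorizableD\<close> and \<open>openly_factorizableI\<close> below, where the carrier
  types are arbitrary.\<close>

definition openly_factorizable :: "'a topology \<Rightarrow> bool" where
  "openly_factorizable X \<longleftrightarrow>
     (\<forall>(Y :: (nat \<Rightarrow> real) topology) f.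
        tychonoff_space Y \<longrightarrow> second_countable Y \<longrightarrow> continuous_map X Y f \<longrightarrow>
        (\<exists>(Z :: (nat \<Rightarrow> real) topology) p g. open_factorization X Y f Z p g))"

definition weakly_Lindelof_space :: "'a topology \<Rightarrow> bool" where
  "weakly_Lindelof_space X \<longleftrightarrow>
     (\<forall>\<U>. (\<forall>U\<in>\<U>. openin X U) \<and> \<Union>\<U> = topspace X \<longrightarrow>
        (\<exists>\<V>. countable \<V> \<and> \<V> \<subseteq> \<U> \<and> X closure_of \<Union>\<V> = topspace X))"

section \<open>Spectra\<close>

text \<open>A partially ordered index set is a pair \<open>(A, r)\<close> with \<open>partial_order_on A r\<close>, where
  \<open>(\<alpha>, \<gamma>) \<in> r\<close> means \<open>\<alpha> \<le> \<gamma>\<close> (and forces both to lie in \<open>A\<close>). The bonding map from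
  \<open>S \<gamma>\<close> to \<open>S \<alpha>\<close> is \<open>\<pi> \<alpha> \<gamma>\<close>.\<close>

definition directed_on :: "'i set \<Rightarrow> 'i rel \<Rightarrow> bool" where
  "directed_on A r \<longleftrightarrow> (\<forall>a\<in>A. \<forall>b\<in>A. \<exists>u\<in>A. (a, u) \<in> r \<and> (b, u) \<in> r)"

definition omega_directed_on :: "'i set \<Rightarrow> 'i rel \<Rightarrow> bool" where
  "omega_directed_on A r \<longleftrightarrow> (\<forall>C. C \<subseteq> A \<and> countable C \<longrightarrow> (\<exists>u\<in>A. \<forall>c\<in>C. (c, u) \<in> r))"

definition spectrum ::
  "'i set \<Rightarrow> 'i rel \<Rightarrow> ('i \<Rightarrow> 'z topology) \<Rightarrow> ('i \<Rightarrow> 'i \<Rightarrow> 'z \<Rightarrow> 'z) \<Rightarrow> bool" where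
  "spectrum A r S \<pi> \<longleftrightarrow>
     partial_order_on A r \<and> directed_on A r \<and>
     (\<forall>\<alpha>\<in>A. tychonoff_space (S \<alpha>)) \<and>
     (\<forall>\<alpha> \<gamma>. (\<alpha>, \<gamma>) \<in> r \<longrightarrow>
        continuous_map (S \<gamma>) (S \<alpha>) (\<pi> \<alpha> \<gamma>) \<and> \<pi> \<alpha> \<gamma> ` topspace (S \<gamma>) = topspace (S \<alpha>)) \<and>
     (\<forall>\<alpha> \<beta> \<gamma>. (\<alpha>, \<beta>) \<in> r \<longrightarrow> (\<beta>, \<gamma>) \<in> r \<longrightarrow>
        (\<forall>x\<in>topspace (S \<gamma>). \<pi> \<alpha> \<gamma> x = \<pi> \<alpha> \<beta> (\<pi> \<beta> \<gamma> x)))"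

definition spectrum_limit ::
  "'i set \<Rightarrow> 'i rel \<Rightarrow> ('i \<Rightarrow> 'z topology) \<Rightarrow> ('i \<Rightarrow> 'i \<Rightarrow> 'z \<Rightarrow> 'z) \<Rightarrow> ('i \<Rightarrow> 'z) topology" where
  "spectrum_limit A r S \<pi> =
     subtopology (product_topology S A) {x. \<forall>\<alpha> \<beta>. (\<alpha>, \<beta>) \<in> r \<longrightarrow> x \<alpha> = \<pi> \<alpha> \<beta> (x \<beta>)}"

definition open_spectrum ::
  "'i set \<Rightarrow> 'i rel \<Rightarrow> ('i \<Rightarrow> 'z topology) \<Rightarrow> ('i \<Rightarrow> 'i \<Rightarrow> 'z \<Rightarrow> 'z) \<Rightarrow> bool" where
  "open_spectrum A r S \<pi> \<longleftrightarrow>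
     spectrum A r S \<pi> \<and> (\<forall>\<alpha> \<gamma>. (\<alpha>, \<gamma>) \<in> r \<longrightarrow> open_map (S \<gamma>) (S \<alpha>) (\<pi> \<alpha> \<gamma>))"

definition omega_spectrum ::
  "'i set \<Rightarrow> 'i rel \<Rightarrow> ('i \<Rightarrow> 'z topology) \<Rightarrow> ('i \<Rightarrow> 'i \<Rightarrow> 'z \<Rightarrow> 'z) \<Rightarrow> bool" where
  "omega_spectrum A r S \<pi> \<longleftrightarrow>
     spectrum A r S \<pi> \<and> omega_directed_on A r \<and> (\<forall>\<alpha>\<in>A. second_countable (S \<alpha>))"

text \<open>\<open>D\<close> is the copy of \<open>X\<close> inside the limit.\<close>

definition spectral_presentation ::
  "'a topology \<Rightarrow> 'i set \<Rightarrow> 'i rel \<Rightarrow> ('i \<Rightarrow> 'z topology) \<Rightarrow> ('i \<Rightarrow> 'i \<Rightarrow> 'z \<Rightarrow> 'z) \<Rightarrow>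
     ('i \<Rightarrow> 'z) set \<Rightarrow> bool" where
  "spectral_presentation X A r S \<pi> D \<longleftrightarrow>
     open_spectrum A r S \<pi> \<and> omega_spectrum A r S \<pi> \<and>
     D \<subseteq> topspace (spectrum_limit A r S \<pi>) \<and>
     spectrum_limit A r S \<pi> closure_of D = topspace (spectrum_limit A r S \<pi>) \<and>
     X homeomorphic_space subtopology (spectrum_limit A r S \<pi>) D \<and>
     (\<forall>\<alpha>\<in>A. open_map (subtopology (spectrum_limit A r S \<pi>) D) (S \<alpha>) (\<lambda>x. x \<alpha>) \<and>
             (\<lambda>x. x \<alpha>) ` D = topspace (S \<alpha>))"

text \<open>Condition \<open>(*)\<close>. The index set is taken inside the type \<^typ>\<open>'a set set\<close> and the spaces of
  the spectrum have carriers in \<^typ>\<open>nat \<Rightarrow> real\<close>. Again nothing is lost: by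
  \<open>dense_in_open_omega_limitI\<close> below, a presentation of \<open>X\<close> over any index type and with any
  carrier type yields one of this form.\<close>

definition dense_in_open_omega_limit :: "'a topology \<Rightarrow> bool" where
  "dense_in_open_omega_limit X \<longleftrightarrow>
     (\<exists>(A :: 'a set set set) r (S :: 'a set set \<Rightarrow> (nat \<Rightarrow> real) topology) \<pi> D.
        spectral_presentation X A r S \<pi> D)"

section \<open>The choice of carrier types is immaterial\<close>

lemma homeomorphic_tychonoff_space:
  "X homeomorphic_space Y \<Longrightarrow> tychonoff_space X \<longleftrightarrow> tychonoff_space Y"
  by (simp add: tychonoff_space_def homeomorphic_completely_regular_space
      homeomorphic_Hausdorff_space)

lemma homeomorphic_map_pullback:
  assumes "inj_on h (topspace Y)"
  shows "homeomorphic_map Y (pullback_topology (h ` topspace Y) (inv_into (topspace Y) h) Y) h"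
proof -
  let ?k = "inv_into (topspace Y) h"
  let ?P = "pullback_topology (h ` topspace Y) ?k Y"
  have top: "topspace ?P = h ` topspace Y"
    using assms by (auto simp: topspace_pullback_topology)
  have "homeomorphic_maps Y ?P h ?k"
    unfolding homeomorphic_maps_def
  proof (intro conjI)
    show "continuous_map Y ?P h"
      by (rule continuous_map_pullback')
        (use assms in \<open>auto intro!: continuous_map_eq[OF continuous_map_id]\<close>)
    show "continuous_map ?P Y ?k"
      using continuous_map_pullback[OF continuous_map_id] by (metis comp_id fun.map_id id_comp)
  qed (use assms top in auto)
  then show ?thesis
    using homeomorphic_maps_map by blast
qed

lemma second_countable_Hausdorff_inj:
  assumes "second_countable Y" "Hausdorff_space Y"
  shows "\<exists>h :: 'a \<Rightarrow> nat \<Rightarrow> real. inj_on h (topspace Y)"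
proof -
  obtain \<B> where B: "countable \<B>" "\<And>V. V \<in> \<B> \<Longrightarrow> openin Y V"
    and base: "\<And>U x. openin Y U \<Longrightarrow> x \<in> U \<Longrightarrow> \<exists>V\<in>\<B>. x \<in> V \<and> V \<subseteq> U"
    using assms(1) unfolding second_countable_def by metis
  define h :: "'a \<Rightarrow> nat \<Rightarrow> real" where
    "h y n = (if \<exists>V\<in>\<B>. to_nat_on \<B> V = n \<and> y \<in> V then 1 else 0)" for y n
  have "x = y" if xy: "x \<in> topspace Y" "y \<in> topspace Y" "h x = h y" for x y
  proof (rule ccontr)
    assume "x \<noteq> y"
    then obtain U where U: "openin Y U" "x \<in> U" "y \<notin> U"
      using assms(2) xy unfolding Hausdorff_space_def disjnt_iff by metis
    then obtain V where V: "V \<in> \<B>" "x \<in> V" "V \<subseteq> U"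
      using base by blast
    then have "h x (to_nat_on \<B> V) = 1"
      unfolding h_def by (intro if_P) blast
    then have "h y (to_nat_on \<B> V) = 1"
      using xy(3) by simp
    then have "\<exists>W\<in>\<B>. to_nat_on \<B> W = to_nat_on \<B> V \<and> y \<in> W"
      unfolding h_def by (rule contrapos_pp) (simp only: if_False zero_neq_one not_False_eq_True)
    then obtain W where "W \<in> \<B>" "to_nat_on \<B> W = to_nat_on \<B> V" "y \<in> W"
      by blast
    then show False
      using V U inj_onD[OF inj_on_to_nat_on[OF B(1)]] by blast
  qed
  then show ?thesis
    unfolding inj_on_def by blast
qed

lemma second_countable_copy:
  assumes "second_countable Y" "tychonoff_space Y"
  obtains Y' :: "(nat \<Rightarrow> real) topology" and h k
  where "second_countable Y'" "tychonoff_space Y'" "homeomorphic_maps Y Y' h k"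
proof -
  obtain h :: "'a \<Rightarrow> nat \<Rightarrow> real" where "inj_on h (topspace Y)"
    using second_countable_Hausdorff_inj assms unfolding tychonoff_space_def by blast
  from homeomorphic_map_pullback[OF this]
  obtain Y' :: "(nat \<Rightarrow> real) topology" and k where hk: "homeomorphic_maps Y Y' h k"
    unfolding homeomorphic_map_maps by blast
  then have hs: "Y homeomorphic_space Y'"
    unfolding homeomorphic_space_def by blast
  show thesis
    by (rule that[OF _ _ hk])
      (use assms homeomorphic_space_second_countability[OF hs] homeomorphic_tychonoff_space[OF hs]
        in simp_all)
qed

lemma homeomorphic_maps_open:
  assumes "homeomorphic_maps Y Z h k"
  shows "open_map Y Z h" "open_map Z Y k"
        "h ` topspace Y = topspace Z" "k ` topspace Z = topspace Y"
proof -
  have "homeomorphic_map Y Z h" "homeomorphic_map Z Y k"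
    using assms homeomorphic_maps_map by blast+
  then show "open_map Y Z h" "open_map Z Y k"
        "h ` topspace Y = topspace Z" "k ` topspace Z = topspace Y"
    by (simp_all add: homeomorphic_imp_open_map homeomorphic_imp_surjective_map)
qed

lemma open_factorization_copy:
  assumes "open_factorization X Y f Z p g" "homeomorphic_maps Z Z' h k"
  shows "open_factorization X Y f Z' (h \<circ> p) (g \<circ> k)"
proof -
  have hs: "Z homeomorphic_space Z'"
    using assms(2) homeomorphic_space_def by blast
  have c: "continuous_map Z Z' h" "continuous_map Z' Z k" "\<forall>z\<in>topspace Z. k (h z) = z"
    using assms(2) unfolding homeomorphic_maps_def by auto
  note o = homeomorphic_maps_open[OF assms(2)]
  have a: "tychonoff_space Z" "second_countable Z" "continuous_map X Z p" "open_map X Z p"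
    "p ` topspace X = topspace Z" "continuous_map Z Y g" "\<forall>x\<in>topspace X. f x = g (p x)"
    using assms(1) unfolding open_factorization_def by auto
  have "tychonoff_space Z'" "second_countable Z'"
    using a(1,2) homeomorphic_tychonoff_space[OF hs] homeomorphic_space_second_countability[OF hs]
    by simp_all
  moreover have "continuous_map X Z' (h \<circ> p)" "continuous_map Z' Y (g \<circ> k)"
    using continuous_map_compose[OF a(3) c(1)] continuous_map_compose[OF c(2) a(6)] .
  moreover have "open_map X Z' (h \<circ> p)"
    using open_map_compose[OF a(4) o(1)] .
  moreover have "(h \<circ> p) ` topspace X = topspace Z'"
    by (metis a(5) image_comp o(3))
  moreover have "\<forall>x\<in>topspace X. f x = (g \<circ> k) ((h \<circ> p) x)"
    using a(5,7) c(3) by (metis comp_apply imageI)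
  ultimately show ?thesis
    unfolding open_factorization_def by blast
qed

lemma openly_factorizableD:
  fixes Y :: "'y topology"
  assumes X: "openly_factorizable X"
    and Y: "tychonoff_space Y" "second_countable Y" and f: "continuous_map X Y f"
  shows "\<exists>(Z :: (nat \<Rightarrow> real) topology) p g. open_factorization X Y f Z p g"
proof -
  obtain Y' :: "(nat \<Rightarrow> real) topology" and h k
    where Y': "second_countable Y'" "tychonoff_space Y'" and hk: "homeomorphic_maps Y Y' h k"
    by (rule second_countable_copy[OF Y(2,1)])
  have c: "continuous_map Y Y' h" "continuous_map Y' Y k" "\<forall>y\<in>topspace Y. k (h y) = y"
    using hk unfolding homeomorphic_maps_def by auto
  have "continuous_map X Y' (h \<circ> f)"
    using continuous_map_compose[OF f c(1)] .
  then obtain Z :: "(nat \<Rightarrow> real) topology" and p g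
    where Z: "open_factorization X Y' (h \<circ> f) Z p g"
    using X Y' unfolding openly_factorizable_def by blast
  have "f x = (k \<circ> g) (p x)" if "x \<in> topspace X" for x
  proof -
    have "f x \<in> topspace Y"
      using f that continuous_map_image_subset_topspace by blast
    then show ?thesis
      using Z that c(3) unfolding open_factorization_def by (metis comp_apply)
  qed
  then have "open_factorization X Y f Z p (k \<circ> g)"
    using Z continuous_map_compose[OF _ c(2), of Z g] unfolding open_factorization_def by simp
  then show ?thesis by blast
qed

lemma openly_factorizableI:
  assumes "\<And>(Y :: (nat \<Rightarrow> real) topology) f.
    tychonoff_space Y \<Longrightarrow> second_countable Y \<Longrightarrow> continuous_map X Y f \<Longrightarrow>
      \<exists>(Z :: 'z topology) p g. open_factorization X Y f Z p g"
  shows "openly_factorizable X"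
  unfolding openly_factorizable_def
proof (intro allI impI)
  fix Y :: "(nat \<Rightarrow> real) topology" and f
  assume "tychonoff_space Y" "second_countable Y" "continuous_map X Y f"
  then obtain Z :: "'z topology" and p g where Z: "open_factorization X Y f Z p g"
    using assms by blast
  then have "second_countable Z" "tychonoff_space Z"
    unfolding open_factorization_def by blast+
  then obtain Z' :: "(nat \<Rightarrow> real) topology" and h k where "homeomorphic_maps Z Z' h k"
    by (rule second_countable_copy)
  then show "\<exists>(Z :: (nat \<Rightarrow> real) topology) p g. open_factorization X Y f Z p g"
    using open_factorization_copy Z by blast
qed

lemma openin_spectrum_limit:
  assumes "openin (spectrum_limit A r S \<pi>) T"
  obtains W where "openin (product_topology S A) W" "T = W \<inter> topspace (spectrum_limit A r S \<pi>)"
proof -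
  obtain W where W: "openin (product_topology S A) W"
      "T = W \<inter> {x. \<forall>\<alpha> \<beta>. (\<alpha>, \<beta>) \<in> r \<longrightarrow> x \<alpha> = \<pi> \<alpha> \<beta> (x \<beta>)}"
    using assms unfolding spectrum_limit_def openin_subtopology by blast
  then have "T = W \<inter> topspace (spectrum_limit A r S \<pi>)"
    using openin_subset[OF W(1)] unfolding spectrum_limit_def topspace_subtopology by blast
  with W(1) show thesis by (rule that)
qed

lemma dense_in_open_omega_limit_saturated:
  fixes X :: "'a topology" and A :: "'a set set set"
    and S :: "'a set set \<Rightarrow> (nat \<Rightarrow> real) topology"
  assumes X: "Hausdorff_space X"
    and S: "\<And>\<alpha>. \<alpha> \<in> A \<Longrightarrow> tychonoff_space (S \<alpha>)" "\<And>\<alpha>. \<alpha> \<in> A \<Longrightarrow> second_countable (S \<alpha>)"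
    and p: "\<And>\<alpha>. \<alpha> \<in> A \<Longrightarrow> continuous_map X (S \<alpha>) (p \<alpha>)" "\<And>\<alpha>. \<alpha> \<in> A \<Longrightarrow> open_map X (S \<alpha>) (p \<alpha>)"
      "\<And>\<alpha>. \<alpha> \<in> A \<Longrightarrow> p \<alpha> ` topspace X = topspace (S \<alpha>)"
    and sat: "\<And>\<alpha>. \<alpha> \<in> A \<Longrightarrow> \<alpha> = {{x \<in> topspace X. p \<alpha> x \<in> U} | U. openin (S \<alpha>) U}"
    and dir: "\<And>C. C \<subseteq> A \<Longrightarrow> countable C \<Longrightarrow> \<exists>u\<in>A. \<forall>c\<in>C. c \<subseteq> u"
    and base: "\<And>W x. openin X W \<Longrightarrow> x \<in> W \<Longrightarrow> \<exists>\<alpha>\<in>A. \<exists>V\<in>\<alpha>. x \<in> V \<and> V \<subseteq> W"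
  shows "dense_in_open_omega_limit X"
proof -
  define r where "r = {(\<alpha>, \<beta>). \<alpha> \<in> A \<and> \<beta> \<in> A \<and> \<alpha> \<subseteq> \<beta>}"
  define \<pi> where "\<pi> = (\<lambda>\<alpha> \<beta> z. p \<alpha> (inv_into (topspace X) (p \<beta>) z))"
  define L where "L = spectrum_limit A r S \<pi>"
  define e where "e = (\<lambda>x. \<lambda>\<alpha>\<in>A. p \<alpha> x)"
  define D where "D = e ` topspace X"
  have fib: "p \<alpha> x = p \<alpha> y"
    if r: "(\<alpha>, \<beta>) \<in> r" and xy: "x \<in> topspace X" "y \<in> topspace X" "p \<beta> x = p \<beta> y" for \<alpha> \<beta> x y
  proof (rule ccontr)
    assume ne: "p \<alpha> x \<noteq> p \<alpha> y"
    have ab: "\<alpha> \<in> A" "\<beta> \<in> A" "\<alpha> \<subseteq> \<beta>"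
      using r by (auto simp: r_def)
    have "p \<alpha> x \<in> topspace (S \<alpha>)" "p \<alpha> y \<in> topspace (S \<alpha>)"
      using p(3)[OF ab(1)] xy by blast+
    then obtain U where U: "openin (S \<alpha>) U" "p \<alpha> x \<in> U" "p \<alpha> y \<notin> U"
      using S(1)[OF ab(1)] ne unfolding tychonoff_space_def Hausdorff_space_def disjnt_iff by metis
    have "{x \<in> topspace X. p \<alpha> x \<in> U} \<in> \<alpha>"
      using sat[OF ab(1)] U(1) by blast
    then have "{x \<in> topspace X. p \<alpha> x \<in> U} \<in> \<beta>"
      using ab(3) by blast
    then obtain V where "{x \<in> topspace X. p \<alpha> x \<in> U} = {x \<in> topspace X. p \<beta> x \<in> V}"
      using sat[OF ab(2)] by blast
    then show False
      using U xy by (metis (mono_tags, lifting) mem_Collect_eq)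
  qed
  have pip: "\<pi> \<alpha> \<beta> (p \<beta> x) = p \<alpha> x" if "(\<alpha>, \<beta>) \<in> r" "x \<in> topspace X" for \<alpha> \<beta> x
    unfolding \<pi>_def using that
    by (intro fib[OF that(1)]) (auto simp: inv_into_into f_inv_into_f)
  have pic: "continuous_map (S \<beta>) (S \<alpha>) (\<pi> \<alpha> \<beta>)" and pio: "open_map (S \<beta>) (S \<alpha>) (\<pi> \<alpha> \<beta>)"
    and pis: "\<pi> \<alpha> \<beta> ` topspace (S \<beta>) = topspace (S \<alpha>)" if r: "(\<alpha>, \<beta>) \<in> r" for \<alpha> \<beta>
  proof -
    have ab: "\<alpha> \<in> A" "\<beta> \<in> A"
      using r by (auto simp: r_def)
    have im: "\<pi> \<alpha> \<beta> ` V = p \<alpha> ` {x \<in> topspace X. p \<beta> x \<in> V}" if "V \<subseteq> topspace (S \<beta>)" for V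
    proof -
      have V: "V = p \<beta> ` {x \<in> topspace X. p \<beta> x \<in> V}"
        using that unfolding p(3)[OF ab(2), symmetric] by blast
      have "\<pi> \<alpha> \<beta> ` V = \<pi> \<alpha> \<beta> ` p \<beta> ` {x \<in> topspace X. p \<beta> x \<in> V}"
        using V by (rule arg_cong)
      also have "\<dots> = p \<alpha> ` {x \<in> topspace X. p \<beta> x \<in> V}"
        unfolding image_image by (rule image_cong) (use pip[OF r] in auto)
      finally show ?thesis .
    qed
    show s: "\<pi> \<alpha> \<beta> ` topspace (S \<beta>) = topspace (S \<alpha>)"
    proof -
      have "{x \<in> topspace X. p \<beta> x \<in> topspace (S \<beta>)} = topspace X"
        unfolding p(3)[OF ab(2), symmetric] by blast
      then show ?thesis
        using im[OF order_refl] p(3)[OF ab(1)] by simp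
    qed
    show "open_map (S \<beta>) (S \<alpha>) (\<pi> \<alpha> \<beta>)"
      unfolding open_map_def
    proof (intro allI impI)
      fix V assume V: "openin (S \<beta>) V"
      have "openin X {x \<in> topspace X. p \<beta> x \<in> V}"
        using openin_continuous_map_preimage[OF p(1)[OF ab(2)] V] .
      then show "openin (S \<alpha>) (\<pi> \<alpha> \<beta> ` V)"
        using im[OF openin_subset[OF V]] p(2)[OF ab(1)] by (simp add: open_map_def)
    qed
    have "quotient_map X (S \<beta>) (p \<beta>)"
      by (rule continuous_open_imp_quotient_map) (rule p ab)+
    moreover have "continuous_map X (S \<alpha>) (\<pi> \<alpha> \<beta> \<circ> p \<beta>)"
      by (rule continuous_map_eq[OF p(1)[OF ab(1)]]) (use pip[OF r] in auto)
    ultimately show "continuous_map (S \<beta>) (S \<alpha>) (\<pi> \<alpha> \<beta>)"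
      by (rule continuous_compose_quotient_map)
  qed
  have po: "partial_order_on A r"
    unfolding order_on_defs r_def refl_on_def trans_def antisym_def by auto
  have "directed_on A r"
    unfolding directed_on_def
  proof (intro ballI)
    fix a b assume "a \<in> A" "b \<in> A"
    then show "\<exists>u\<in>A. (a, u) \<in> r \<and> (b, u) \<in> r"
      using dir[of "{a, b}"] by (auto simp: r_def)
  qed
  moreover have "\<pi> \<alpha> \<gamma> x = \<pi> \<alpha> \<beta> (\<pi> \<beta> \<gamma> x)"
    if r: "(\<alpha>, \<beta>) \<in> r" "(\<beta>, \<gamma>) \<in> r" and x: "x \<in> topspace (S \<gamma>)" for \<alpha> \<beta> \<gamma> x
  proof -
    have "(\<alpha>, \<gamma>) \<in> r" "\<gamma> \<in> A"
      using r by (auto simp: r_def)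
    moreover from this obtain y where "y \<in> topspace X" "x = p \<gamma> y"
      using p(3)[of \<gamma>] x by blast
    ultimately show ?thesis
      using pip r by simp
  qed
  ultimately have spec: "spectrum A r S \<pi>"
    unfolding spectrum_def using po S pic pis by blast
  have "omega_directed_on A r"
    unfolding omega_directed_on_def
  proof (intro allI impI)
    fix C assume C: "C \<subseteq> A \<and> countable C"
    then obtain u where u: "u \<in> A" "\<forall>c\<in>C. c \<subseteq> u"
      using dir[of C] by blast
    have "(c, u) \<in> r" if "c \<in> C" for c
      using u C that by (simp add: r_def subsetD[of C A])
    then show "\<exists>u\<in>A. \<forall>c\<in>C. (c, u) \<in> r"
      using u(1) by (intro bexI[of _ u] ballI)
  qed
  then have os: "omega_spectrum A r S \<pi>" "open_spectrum A r S \<pi>"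
    unfolding omega_spectrum_def open_spectrum_def by (simp_all add: spec S(2) pio)
  have topL: "topspace L =
      {z \<in> (\<Pi>\<^sub>E i\<in>A. topspace (S i)). \<forall>\<alpha> \<beta>. (\<alpha>, \<beta>) \<in> r \<longrightarrow> z \<alpha> = \<pi> \<alpha> \<beta> (z \<beta>)}"
    unfolding L_def spectrum_limit_def by auto
  have eL: "e x \<in> topspace L" if "x \<in> topspace X" for x
    unfolding topL e_def using that p(3) pip by (auto simp: r_def)
  have DL: "D \<subseteq> topspace L"
    using eL by (auto simp: D_def)
  have proj: "continuous_map L (S \<alpha>) (\<lambda>z. z \<alpha>)" if "\<alpha> \<in> A" for \<alpha>
    unfolding L_def spectrum_limit_def
    by (intro continuous_map_from_subtopology continuous_map_product_projection that)
  have ec: "continuous_map X (subtopology L D) e"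
    unfolding L_def spectrum_limit_def continuous_map_in_subtopology
  proof (intro conjI)
    show "continuous_map X (product_topology S A) e"
      unfolding continuous_map_componentwise
    proof (intro conjI ballI)
      show "e ` topspace X \<subseteq> extensional A"
        by (auto simp: e_def)
      fix k assume k: "k \<in> A"
      show "continuous_map X (S k) (\<lambda>x. e x k)"
        by (rule continuous_map_eq[OF p(1)[OF k]]) (use k in \<open>auto simp: e_def\<close>)
    qed
    show "e \<in> topspace X \<rightarrow> {x. \<forall>\<alpha> \<beta>. (\<alpha>, \<beta>) \<in> r \<longrightarrow> x \<alpha> = \<pi> \<alpha> \<beta> (x \<beta>)}"
      using eL topL by blast
    show "e \<in> topspace X \<rightarrow> D"
      by (auto simp: D_def)
  qed
  have eo: "open_map X (subtopology L D) e"
    unfolding open_map_def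
  proof (intro allI impI)
    fix W assume W: "openin X W"
    define T where "T = \<Union>{{z \<in> topspace L. z \<alpha> \<in> U} | \<alpha> U. \<alpha> \<in> A \<and> openin (S \<alpha>) U \<and>
        {x \<in> topspace X. p \<alpha> x \<in> U} \<subseteq> W}"
    have "openin L T"
      unfolding T_def using openin_continuous_map_preimage[OF proj]
      by (intro openin_Union) auto
    moreover have "e ` W = T \<inter> D"
    proof (intro equalityI subsetI)
      fix z assume "z \<in> e ` W"
      then obtain x where x: "x \<in> W" "z = e x" by blast
      obtain \<alpha> V where V: "\<alpha> \<in> A" "V \<in> \<alpha>" "x \<in> V" "V \<subseteq> W"
        using base[OF W x(1)] by blast
      obtain U where U: "openin (S \<alpha>) U" "V = {x \<in> topspace X. p \<alpha> x \<in> U}"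
        using sat[OF V(1)] V(2) by blast
      have xX: "x \<in> topspace X"
        using U V by blast
      then have "z \<in> {z \<in> topspace L. z \<alpha> \<in> U}"
        using eL x U V by (auto simp: e_def)
      moreover have "z \<in> D"
        using x xX by (auto simp: D_def)
      ultimately show "z \<in> T \<inter> D"
        unfolding T_def using U V by blast
    next
      fix z assume z: "z \<in> T \<inter> D"
      then obtain x where x: "x \<in> topspace X" "z = e x"
        by (auto simp: D_def)
      obtain \<alpha> U where "\<alpha> \<in> A" "{x \<in> topspace X. p \<alpha> x \<in> U} \<subseteq> W" "z \<alpha> \<in> U"
        using z by (auto simp: T_def)
      then show "z \<in> e ` W"
        using x by (auto simp: e_def)
    qed
    ultimately show "openin (subtopology L D) (e ` W)"
      by (auto simp: openin_subtopology)
  qed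
  have einj: "inj_on e (topspace X)"
  proof (rule inj_onI, rule ccontr)
    fix x y assume xy: "x \<in> topspace X" "y \<in> topspace X" "e x = e y" "x \<noteq> y"
    then obtain W where W: "openin X W" "x \<in> W" "y \<notin> W"
      using X unfolding Hausdorff_space_def disjnt_iff by metis
    obtain \<alpha> V where V: "\<alpha> \<in> A" "V \<in> \<alpha>" "x \<in> V" "V \<subseteq> W"
      using base[OF W(1,2)] by blast
    obtain U where U: "V = {x \<in> topspace X. p \<alpha> x \<in> U}"
      using sat[OF V(1)] V(2) by blast
    have "p \<alpha> x = p \<alpha> y"
      using xy(3) V(1) by (metis e_def restrict_apply')
    then show False
      using U V W xy by auto
  qed
  have topD: "topspace (subtopology L D) = D"
    using DL by auto
  have hm: "homeomorphic_map X (subtopology L D) e"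
    by (rule bijective_open_imp_homeomorphic_map[OF ec eo _ einj]) (use topD in \<open>simp only: D_def\<close>)
  have dense: "L closure_of D = topspace L"
    unfolding dense_intersects_open
  proof (intro allI impI)
    fix T assume T: "openin L T \<and> T \<noteq> {}"
    then obtain z where "z \<in> T" by blast
    moreover from T obtain W where "openin (product_topology S A) W" "T = W \<inter> topspace L"
      unfolding L_def by (blast elim: openin_spectrum_limit)
    ultimately have W: "openin (product_topology S A) W" "T = W \<inter> topspace L" "z \<in> T"
      by blast+
    obtain U where U: "finite {i \<in> A. U i \<noteq> topspace (S i)}" "z \<in> Pi\<^sub>E A U" "Pi\<^sub>E A U \<subseteq> W"
      using W unfolding openin_product_topology_alt by auto
    obtain u where u: "u \<in> A" "\<forall>i\<in>{i \<in> A. U i \<noteq> topspace (S i)}. i \<subseteq> u"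
      using dir[of "{i \<in> A. U i \<noteq> topspace (S i)}"] U(1) countable_finite by blast
    have zL: "z \<in> topspace L"
      using W by blast
    then have "z u \<in> topspace (S u)"
      using u(1) by (auto simp: topL)
    then obtain x where x: "x \<in> topspace X" "z u = p u x"
      unfolding p(3)[OF u(1), symmetric] by blast
    have "p i x \<in> U i" if i: "i \<in> A" for i
    proof (cases "U i = topspace (S i)")
      case True
      then show ?thesis using p(3)[OF i] x by blast
    next
      case False
      then have iu: "(i, u) \<in> r"
        using u i by (auto simp: r_def)
      then have "z i = \<pi> i u (p u x)"
        using zL x by (auto simp: topL)
      then show ?thesis
        using pip[OF iu x(1)] PiE_mem[OF U(2) i] by simp
    qed
    then have "e x \<in> Pi\<^sub>E A U"
      by (auto simp: e_def)
    then show "D \<inter> T \<noteq> {}"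
      using U(3) W(2) eL[OF x(1)] x(1) by (auto simp: D_def)
  qed
  have "open_map (subtopology L D) (S \<alpha>) (\<lambda>z. z \<alpha>) \<and> (\<lambda>z. z \<alpha>) ` D = topspace (S \<alpha>)"
    if a: "\<alpha> \<in> A" for \<alpha>
  proof
    show "(\<lambda>z. z \<alpha>) ` D = topspace (S \<alpha>)"
      using p(3)[OF a] a by (auto simp: D_def e_def image_image)
    show "open_map (subtopology L D) (S \<alpha>) (\<lambda>z. z \<alpha>)"
      unfolding open_map_def
    proof (intro allI impI)
      fix V assume V: "openin (subtopology L D) V"
      have W: "openin X {x \<in> topspace X. e x \<in> V}"
        using openin_continuous_map_preimage[OF ec V] .
      have "V \<subseteq> D"
        using openin_subset[OF V] topD by simp
      then have "V = e ` {x \<in> topspace X. e x \<in> V}"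
        unfolding D_def by blast
      then have "(\<lambda>z. z \<alpha>) ` V = (\<lambda>z. z \<alpha>) ` e ` {x \<in> topspace X. e x \<in> V}"
        by (rule arg_cong)
      also have "\<dots> = p \<alpha> ` {x \<in> topspace X. e x \<in> V}"
        unfolding image_image by (rule image_cong) (use a in \<open>auto simp: e_def\<close>)
      finally have "(\<lambda>z. z \<alpha>) ` V = p \<alpha> ` {x \<in> topspace X. e x \<in> V}" .
      then show "openin (S \<alpha>) ((\<lambda>z. z \<alpha>) ` V)"
        using W p(2)[OF a] by (simp add: open_map_def)
    qed
  qed
  then have "spectral_presentation X A r S \<pi> D"
    unfolding spectral_presentation_def L_def[symmetric]
    using os DL dense homeomorphic_map_imp_homeomorphic_space[OF hm] by blast
  then show ?thesis
    unfolding dense_in_open_omega_limit_def by blast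
qed

lemma dense_in_open_omega_limitI:
  fixes X :: "'a topology" and A :: "'i set" and S :: "'i \<Rightarrow> 'z topology"
  assumes pres: "spectral_presentation X A r S \<pi> D"
  shows "dense_in_open_omega_limit X"
proof -
  define L where "L = spectrum_limit A r S \<pi>"
  have os: "open_spectrum A r S \<pi>" "omega_spectrum A r S \<pi>" and DL: "D \<subseteq> topspace L"
    and hs: "X homeomorphic_space subtopology L D"
    and projo: "\<And>\<alpha>. \<alpha> \<in> A \<Longrightarrow> open_map (subtopology L D) (S \<alpha>) (\<lambda>x. x \<alpha>)"
    and projs: "\<And>\<alpha>. \<alpha> \<in> A \<Longrightarrow> (\<lambda>x. x \<alpha>) ` D = topspace (S \<alpha>)"
    using pres unfolding spectral_presentation_def L_def by blast+
  have spec: "spectrum A r S \<pi>" and od: "omega_directed_on A r"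
    and Ssc: "\<And>\<alpha>. \<alpha> \<in> A \<Longrightarrow> second_countable (S \<alpha>)"
    using os unfolding omega_spectrum_def by blast+
  have Sty: "\<And>\<alpha>. \<alpha> \<in> A \<Longrightarrow> tychonoff_space (S \<alpha>)"
    and pic: "\<And>\<alpha> \<beta>. (\<alpha>, \<beta>) \<in> r \<Longrightarrow> continuous_map (S \<beta>) (S \<alpha>) (\<pi> \<alpha> \<beta>)"
    and po: "partial_order_on A r"
    using spec unfolding spectrum_def by blast+
  have rA: "\<And>\<alpha> \<beta>. (\<alpha>, \<beta>) \<in> r \<Longrightarrow> \<alpha> \<in> A \<and> \<beta> \<in> A"
    using po unfolding order_on_defs by blast
  have topD: "topspace (subtopology L D) = D"
    using DL by auto
  have topL: "topspace L =
      {z \<in> (\<Pi>\<^sub>E i\<in>A. topspace (S i)). \<forall>\<alpha> \<beta>. (\<alpha>, \<beta>) \<in> r \<longrightarrow> z \<alpha> = \<pi> \<alpha> \<beta> (z \<beta>)}"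
    unfolding L_def spectrum_limit_def by auto
  obtain f where f: "homeomorphic_map X (subtopology L D) f"
    using hs homeomorphic_space by blast
  have fc: "continuous_map X (subtopology L D) f" and fo: "open_map X (subtopology L D) f"
    and fs: "f ` topspace X = D" and fi: "inj_on f (topspace X)"
    using f topD homeomorphic_imp_continuous_map homeomorphic_imp_open_map
      homeomorphic_imp_surjective_map[OF f] homeomorphic_imp_injective_map by auto
  define p where "p = (\<lambda>\<alpha> x. f x \<alpha>)"
  have pr: "\<pi> \<alpha> \<beta> (p \<beta> x) = p \<alpha> x" if "(\<alpha>, \<beta>) \<in> r" "x \<in> topspace X" for \<alpha> \<beta> x
  proof -
    have "f x \<in> topspace L"
      using that fs DL by blast
    then show ?thesis
      using that(1) by (simp add: topL p_def)
  qed
  have pc: "continuous_map X (S \<alpha>) (p \<alpha>)" if "\<alpha> \<in> A" for \<alpha>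
  proof -
    have "continuous_map (subtopology L D) (S \<alpha>) (\<lambda>z. z \<alpha>)"
      unfolding L_def spectrum_limit_def
      by (intro continuous_map_from_subtopology continuous_map_product_projection that)
    from continuous_map_compose[OF fc this] show ?thesis
      by (simp add: p_def comp_def)
  qed
  have pop: "open_map X (S \<alpha>) (p \<alpha>)" if "\<alpha> \<in> A" for \<alpha>
    using open_map_compose[OF fo projo[OF that]] by (simp add: p_def comp_def)
  have ps: "p \<alpha> ` topspace X = topspace (S \<alpha>)" if "\<alpha> \<in> A" for \<alpha>
    using projs[OF that] unfolding p_def fs[symmetric] image_image .
  define Op where "Op = (\<lambda>\<alpha>. {{x \<in> topspace X. p \<alpha> x \<in> U} | U. openin (S \<alpha>) U})"
  have mono: "Op \<alpha> \<subseteq> Op \<beta>" if r: "(\<alpha>, \<beta>) \<in> r" for \<alpha> \<beta>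
  proof
    fix V assume "V \<in> Op \<alpha>"
    then obtain U where U: "openin (S \<alpha>) U" "V = {x \<in> topspace X. p \<alpha> x \<in> U}"
      unfolding Op_def by blast
    have "V = {x \<in> topspace X. p \<beta> x \<in> {z \<in> topspace (S \<beta>). \<pi> \<alpha> \<beta> z \<in> U}}"
      using U(2) pr[OF r] ps rA[OF r] by auto
    moreover have "openin (S \<beta>) {z \<in> topspace (S \<beta>). \<pi> \<alpha> \<beta> z \<in> U}"
      using openin_continuous_map_preimage[OF pic[OF r] U(1)] .
    ultimately show "V \<in> Op \<beta>"
      unfolding Op_def by blast
  qed
  define P where "P = (\<lambda>a (T :: (nat \<Rightarrow> real) topology) q. tychonoff_space T \<and>
      second_countable T \<and> continuous_map X T q \<and> open_map X T q \<and>
      q ` topspace X = topspace T \<and> a = {{x \<in> topspace X. q x \<in> U} | U. openin T U})"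
  have copy: "\<exists>T q. P a T q" if a: "a \<in> Op ` A" for a
  proof -
    obtain \<alpha> where al: "\<alpha> \<in> A" "a = Op \<alpha>"
      using a by blast
    obtain T :: "(nat \<Rightarrow> real) topology" and h k
      where T: "second_countable T" "tychonoff_space T" and hk: "homeomorphic_maps (S \<alpha>) T h k"
      by (rule second_countable_copy[OF Ssc[OF al(1)] Sty[OF al(1)]])
    have c: "continuous_map (S \<alpha>) T h" "continuous_map T (S \<alpha>) k" "\<forall>z\<in>topspace (S \<alpha>). k (h z) = z"
      using hk unfolding homeomorphic_maps_def by auto
    note o = homeomorphic_maps_open[OF hk]
    have pt: "p \<alpha> x \<in> topspace (S \<alpha>)" if "x \<in> topspace X" for x
      using ps[OF al(1)] that by blast
    have "a = {{x \<in> topspace X. (h \<circ> p \<alpha>) x \<in> U} | U. openin T U}"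
    proof (intro equalityI subsetI)
      fix V assume "V \<in> a"
      then obtain U where U: "openin (S \<alpha>) U" "V = {x \<in> topspace X. p \<alpha> x \<in> U}"
        unfolding al(2) Op_def by blast
      have "V = {x \<in> topspace X. (h \<circ> p \<alpha>) x \<in> h ` U}"
        using U pt c(3) openin_subset[OF U(1)] by (auto simp: image_iff) (metis subsetD)
      moreover have "openin T (h ` U)"
        using o(1) U(1) by (simp add: open_map_def)
      ultimately show "V \<in> {{x \<in> topspace X. (h \<circ> p \<alpha>) x \<in> U} | U. openin T U}"
        by blast
    next
      fix V assume "V \<in> {{x \<in> topspace X. (h \<circ> p \<alpha>) x \<in> U} | U. openin T U}"
      then obtain U where U: "openin T U" "V = {x \<in> topspace X. (h \<circ> p \<alpha>) x \<in> U}"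
        by blast
      have "V = {x \<in> topspace X. p \<alpha> x \<in> {z \<in> topspace (S \<alpha>). h z \<in> U}}"
        using U pt by auto
      moreover have "openin (S \<alpha>) {z \<in> topspace (S \<alpha>). h z \<in> U}"
        using openin_continuous_map_preimage[OF c(1) U(1)] .
      ultimately show "V \<in> a"
        unfolding al(2) Op_def by blast
    qed
    moreover have "(h \<circ> p \<alpha>) ` topspace X = topspace T"
      using ps[OF al(1)] o(3) by (metis image_comp)
    ultimately show ?thesis
      unfolding P_def
      using T continuous_map_compose[OF pc[OF al(1)] c(1)] open_map_compose[OF pop[OF al(1)] o(1)]
      by blast
  qed
  then obtain T :: "'a set set \<Rightarrow> (nat \<Rightarrow> real) topology" and q
    where Tq: "\<And>a. a \<in> Op ` A \<Longrightarrow> P a (T a) (q a)"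
    by metis
  show ?thesis
  proof (rule dense_in_open_omega_limit_saturated[where A = "Op ` A" and S = T and p = q])
    have "Hausdorff_space L"
      unfolding L_def spectrum_limit_def using Sty
      by (intro Hausdorff_space_subtopology)
        (auto simp: Hausdorff_space_product_topology tychonoff_space_def)
    then show "Hausdorff_space X"
      using homeomorphic_Hausdorff_space[OF hs] Hausdorff_space_subtopology by blast
  next
    fix C assume C: "C \<subseteq> Op ` A" "countable C"
    then obtain B where B: "countable B" "B \<subseteq> A" "C = Op ` B"
      using countable_subset_image[of C Op A] by blast
    then obtain u where "u \<in> A" "\<forall>c\<in>B. (c, u) \<in> r"
      using od unfolding omega_directed_on_def by blast
    then show "\<exists>u\<in>Op ` A. \<forall>c\<in>C. c \<subseteq> u"
      using B(3) mono by blast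
  next
    fix W x assume W: "openin X W" "x \<in> W"
    have xX: "x \<in> topspace X"
      using W openin_subset by blast
    have "openin (subtopology L D) (f ` W)"
      using fo W by (simp add: open_map_def)
    then obtain G' where G': "openin L G'" "f ` W = G' \<inter> D"
      unfolding openin_subtopology by blast
    then obtain G where G: "openin (product_topology S A) G" "G' = G \<inter> topspace L"
      unfolding L_def by (blast elim: openin_spectrum_limit)
    then have "f ` W = G \<inter> D"
      using G'(2) DL by blast
    note G = G(1) this
    have fxG: "f x \<in> G"
      using G W by blast
    obtain U where U: "finite {i \<in> A. U i \<noteq> topspace (S i)}" "\<And>i. i \<in> A \<Longrightarrow> openin (S i) (U i)"
        "f x \<in> Pi\<^sub>E A U" "Pi\<^sub>E A U \<subseteq> G"
      using G(1) fxG unfolding openin_product_topology_alt by meson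
    define F where "F = {i \<in> A. U i \<noteq> topspace (S i)}"
    have F: "finite F" "F \<subseteq> A"
      using U(1) by (auto simp: F_def)
    then obtain u where u: "u \<in> A" "\<forall>i\<in>F. (i, u) \<in> r"
      using od countable_finite unfolding omega_directed_on_def by metis
    define V where "V = topspace (S u) \<inter> \<Inter>((\<lambda>i. {z \<in> topspace (S u). \<pi> i u z \<in> U i}) ` F)"
    have Vo: "openin (S u) V"
    proof -
      have "openin (S u) {z \<in> topspace (S u). \<pi> i u z \<in> U i}" if "i \<in> F" for i
        using openin_continuous_map_preimage[OF pic U(2)] u that F by blast
      then show ?thesis
        unfolding V_def by (intro openin_Int_Inter) (use F in auto)
    qed
    have "p u x \<in> V"
    proof -
      have "\<pi> i u (p u x) \<in> U i" if "i \<in> F" for i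
        using pr[of i u x] u that xX U(3) F(2) by (auto simp: p_def)
      then show ?thesis
        using ps[OF u(1)] xX by (auto simp: V_def)
    qed
    moreover have "y \<in> W" if y: "y \<in> topspace X" "p u y \<in> V" for y
    proof -
      have fyL: "f y \<in> topspace L" and fyD: "f y \<in> D"
        using y fs DL by blast+
      have "f y i \<in> U i" if i: "i \<in> A" for i
      proof (cases "i \<in> F")
        case True
        then have "\<pi> i u (p u y) \<in> U i"
          using y(2) by (auto simp: V_def)
        then show ?thesis
          using pr[of i u y] u True y(1) by (simp add: p_def)
      next
        case False
        then show ?thesis
          using fyL i by (auto simp: F_def topL)
      qed
      then have "f y \<in> Pi\<^sub>E A U"
        using fyL by (auto simp: topL PiE_iff)
      then have "f y \<in> f ` W"
        using U(4) G(2) fyD by blast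
      then show ?thesis
        using fi y(1) W(1) openin_subset inj_on_image_mem_iff by metis
    qed
    ultimately show "\<exists>\<alpha>\<in>Op ` A. \<exists>V\<in>\<alpha>. x \<in> V \<and> V \<subseteq> W"
      using u(1) xX Vo
      by (intro bexI[of _ "Op u"] bexI[of _ "{x \<in> topspace X. p u x \<in> V}"]) (auto simp: Op_def)
  next
    fix a assume a: "a \<in> Op ` A"
    note t = Tq[OF a, unfolded P_def]
    show "tychonoff_space (T a)" using t by (elim conjE)
    show "second_countable (T a)" using t by (elim conjE)
    show "continuous_map X (T a) (q a)" using t by (elim conjE)
    show "open_map X (T a) (q a)" using t by (elim conjE)
    show "q a ` topspace X = topspace (T a)" using t by (elim conjE)
    show "a = {{x \<in> topspace X. q a x \<in> U} | U. openin (T a) U}" using t by (elim conjE)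
  qed
qed

end

theory Submission
  imports Defs
begin

text \<open>
  Both directions compare a map \<open>p\<close> on \<open>X\<close> with the family of open subsets of \<open>X\<close> that it pulls
  back from its target, called \<open>pulled_back_opens\<close> below. A larger family means a finer map: if
  \<open>f\<close> factors continuously through \<open>p\<close>, then the family of \<open>f\<close> is contained in that of \<open>p\<close>.

  If \<open>X\<close> is openly factorizable, the spectrum consists of all continuous open images of \<open>X\<close> that are
  second countable and Tychonoff, indexed by their families of pulled back open sets and ordered by
  inclusion. Countably many of these images have an upper bound, because the diagonal map into
  their product has a second countable Tychonoff target and so factors through one more open image.
  The pulled back sets form a base of \<open>X\<close>, because a real-valued function that separates a
  point from a closed set factors through an open image too. By \<open>dense_in_open_omega_limit_saturated\<close>
  these two facts suffice.

  Conversely, let \<open>X\<close> be weakly Lindelof and densely embedded in the limit of an open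
  \<open>\<omega>\<close>-spectrum, with open surjective projections \<open>p \<alpha>\<close>, and let \<open>f\<close> map \<open>X\<close> to a second
  countable Tychonoff space. It is enough to find one \<open>u\<close> such that \<open>f\<close> is constant on the
  fibres of \<open>p u\<close>, as \<open>p u\<close> is a quotient map. Distinct points of the target are separated by open sets \<open>U\<close>, \<open>V\<close>
  with disjoint closures, taken from a countable base. For each such pair the sets that are pulled
  back along some projection and whose image under \<open>f\<close> misses \<open>U\<close> or misses \<open>V\<close> cover \<open>X\<close>, so
  countably many of them have dense union. Over all pairs only countably many sets are chosen, and
  by \<open>\<omega>\<close>-directedness one \<open>p u\<close> pulls all of them back. If \<open>p u\<close> agreed at points \<open>x\<close>, \<open>y\<close>
  with \<open>f x \<in> U\<close> and \<open>f y \<in> V\<close>, openness of \<open>p u\<close> would give points arbitrarily close to \<open>x\<close> and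
  to \<open>y\<close> on a common fibre that lies in one of the chosen sets, whose image would then
  meet both \<open>U\<close> and \<open>V\<close>. This is \<open>openly_factorizable_if_directed_open_images\<close>.
\<close>

section \<open>Countable products and separation by a countable base\<close>

lemma second_countable_product_topology:
  assumes I: "countable I" and S: "\<And>i. i \<in> I \<Longrightarrow> second_countable (S i)"
  shows "second_countable (product_topology S I)"
proof -
  let ?P = "product_topology S I"
  have "\<exists>\<B>. countable \<B> \<and> (\<forall>V\<in>\<B>. openin (S i) V) \<and>
      (\<forall>U x. openin (S i) U \<and> x \<in> U \<longrightarrow> (\<exists>V\<in>\<B>. x \<in> V \<and> V \<subseteq> U))" if "i \<in> I" for i
    using S[OF that] unfolding second_countable_def .
  then obtain \<B> where B: "\<And>i. i \<in> I \<Longrightarrow> countable (\<B> i)" "\<And>i V. i \<in> I \<Longrightarrow> V \<in> \<B> i \<Longrightarrow> openin (S i) V"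
    and base: "\<And>i U x. i \<in> I \<Longrightarrow> openin (S i) U \<Longrightarrow> x \<in> U \<Longrightarrow> \<exists>V\<in>\<B> i. x \<in> V \<and> V \<subseteq> U"
    by metis
  \<comment> \<open>A finite set of pairs \<open>(i, V)\<close> encodes a basic box; there are countably many such sets.\<close>
  define box where "box F = {z \<in> topspace ?P. \<forall>(i, V)\<in>F. z i \<in> V}" for F
  define \<F> where "\<F> = {F. finite F \<and> F \<subseteq> Sigma I \<B>}"
  have "countable \<F>"
    unfolding \<F>_def by (intro countable_Collect_finite_subset countable_SIGMA I B(1))
  moreover have "openin ?P (box F)" if F: "F \<in> \<F>" for F
  proof -
    have "openin ?P {z \<in> topspace ?P. z i \<in> V}" if "(i, V) \<in> F" for i V
      using F that B(2) unfolding \<F>_def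
      by (intro openin_continuous_map_preimage[OF continuous_map_product_projection]) auto
    then have "openin ?P (topspace ?P \<inter> \<Inter>((\<lambda>(i, V). {z \<in> topspace ?P. z i \<in> V}) ` F))"
      using F by (intro openin_Int_Inter openin_topspace) (auto simp: \<F>_def)
    also have "topspace ?P \<inter> \<Inter>((\<lambda>(i, V). {z \<in> topspace ?P. z i \<in> V}) ` F) = box F"
      unfolding box_def by auto
    finally show ?thesis .
  qed
  moreover have "\<exists>F\<in>\<F>. z \<in> box F \<and> box F \<subseteq> W" if W: "openin ?P W" "z \<in> W" for W z
  proof -
    obtain U where U: "finite {i \<in> I. U i \<noteq> topspace (S i)}" "\<And>i. i \<in> I \<Longrightarrow> openin (S i) (U i)"
        "z \<in> Pi\<^sub>E I U" "Pi\<^sub>E I U \<subseteq> W"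
      using W unfolding openin_product_topology_alt by meson
    have zP: "z \<in> topspace ?P"
      using W openin_subset by blast
    have "\<exists>V\<in>\<B> i. z i \<in> V \<and> V \<subseteq> U i" if "i \<in> I" for i
      using base[OF that U(2)[OF that]] U(3) that by auto
    then obtain V where V: "\<And>i. i \<in> I \<Longrightarrow> V i \<in> \<B> i \<and> z i \<in> V i \<and> V i \<subseteq> U i"
      by metis
    define F where "F = (\<lambda>i. (i, V i)) ` {i \<in> I. U i \<noteq> topspace (S i)}"
    have "F \<in> \<F>"
      using U(1) V by (auto simp: F_def \<F>_def)
    moreover have "z \<in> box F"
      using zP V by (auto simp: F_def box_def)
    moreover have "y \<in> Pi\<^sub>E I U" if y: "y \<in> box F" for y
    proof -
      have "y \<in> topspace ?P" "\<And>i. i \<in> I \<Longrightarrow> U i \<noteq> topspace (S i) \<Longrightarrow> y i \<in> V i"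
        using y by (auto simp: box_def F_def)
      then show ?thesis
        using V unfolding topspace_product_topology PiE_iff by blast
    qed
    ultimately show ?thesis
      using U(4) by blast
  qed
  ultimately show ?thesis
    unfolding second_countable_def by (intro exI[of _ "box ` \<F>"]) auto
qed

lemma tychonoff_space_product_topology:
  assumes "\<And>i. i \<in> I \<Longrightarrow> tychonoff_space (S i)"
  shows "tychonoff_space (product_topology S I)"
  using assms
  by (simp add: tychonoff_space_def completely_regular_space_product_topology
      Hausdorff_space_product_topology)

lemma second_countable_tychonoff_euclideanreal:
  "second_countable euclideanreal" "tychonoff_space euclideanreal"
proof -
  obtain \<B> :: "real set set" where "countable \<B>" "topological_basis \<B>"
    using ex_countable_basis by blast
  then show "second_countable euclideanreal"
    unfolding second_countable_def by (metis open_openin topological_basisE topological_basis_open)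
  show "tychonoff_space euclideanreal"
    by (simp add: tychonoff_space_def metrizable_imp_completely_regular_space
        metrizable_space_euclidean)
qed

text \<open>Regularity shrinks base sets so that their closures lie in a prescribed open set. Applied twice,
  this turns Hausdorff separation into separation by disjoint closures. The closures matter because
  the complements of two disjoint closed sets form an open cover.\<close>
lemma countable_base_separating_closures:
  assumes "second_countable Y" "tychonoff_space Y"
  obtains \<B> where "countable \<B>" "\<forall>U\<in>\<B>. openin Y U"
    "\<forall>x\<in>topspace Y. \<forall>y\<in>topspace Y. x \<noteq> y \<longrightarrow>
      (\<exists>U\<in>\<B>. \<exists>V\<in>\<B>. x \<in> U \<and> y \<in> V \<and> Y closure_of U \<inter> Y closure_of V = {})"
proof -
  obtain \<B> where B: "countable \<B>" "\<forall>V\<in>\<B>. openin Y V"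
    and base: "\<And>U x. openin Y U \<Longrightarrow> x \<in> U \<Longrightarrow> \<exists>V\<in>\<B>. x \<in> V \<and> V \<subseteq> U"
    using assms(1) unfolding second_countable_def by metis
  have reg: "neighbourhood_base_of (closedin Y) Y" and T1: "t1_space Y"
    using assms(2) completely_regular_imp_regular_space neighbourhood_base_of_closedin
      Hausdorff_imp_t1_space unfolding tychonoff_space_def by blast+
  have shrink: "\<exists>V\<in>\<B>. x \<in> V \<and> Y closure_of V \<subseteq> U" if xU: "openin Y U" "x \<in> U" for U x
  proof -
    obtain G C where G: "openin Y G" "closedin Y C" "x \<in> G" "G \<subseteq> C" "C \<subseteq> U"
      using reg[unfolded neighbourhood_base_of] xU by metis
    then obtain V where V: "V \<in> \<B>" "x \<in> V" "V \<subseteq> G"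
      using base by blast
    then have "Y closure_of V \<subseteq> C"
      using G by (intro closure_of_minimal) auto
    then show ?thesis
      using V G by blast
  qed
  have "\<exists>U\<in>\<B>. \<exists>V\<in>\<B>. x \<in> U \<and> y \<in> V \<and> Y closure_of U \<inter> Y closure_of V = {}"
    if xy: "x \<in> topspace Y" "y \<in> topspace Y" "x \<noteq> y" for x y
  proof -
    have "openin Y (topspace Y - {y})"
      using closedin_t1_singleton[OF T1 xy(2)] by (simp add: openin_diff)
    then obtain U where U: "U \<in> \<B>" "x \<in> U" "Y closure_of U \<subseteq> topspace Y - {y}"
      using shrink xy by blast
    have "openin Y (topspace Y - Y closure_of U)"
      by (simp add: openin_diff)
    then obtain V where "V \<in> \<B>" "y \<in> V" "Y closure_of V \<subseteq> topspace Y - Y closure_of U"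
      using shrink[of _ y] xy U by blast
    then show ?thesis
      using U by blast
  qed
  then show thesis
    using that[OF B] by blast
qed

section \<open>Open sets pulled back along a map\<close>

definition pulled_back_opens :: "'a topology \<Rightarrow> 'z topology \<Rightarrow> ('a \<Rightarrow> 'z) \<Rightarrow> 'a set set" where
  "pulled_back_opens X Z p = {{x \<in> topspace X. p x \<in> U} | U. openin Z U}"

text \<open>This monotonicity is what makes inclusion of pulled back families the right order on a
  spectrum: it applies to bonding maps and to the projections of a product.\<close>
lemma pulled_back_opens_factor:
  assumes g: "continuous_map Z Y g" and f: "\<And>x. x \<in> topspace X \<Longrightarrow> f x = g (p x)"
    and p: "p ` topspace X \<subseteq> topspace Z"
  shows "pulled_back_opens X Y f \<subseteq> pulled_back_opens X Z p"
proof
  fix W assume "W \<in> pulled_back_opens X Y f"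
  then obtain U where U: "openin Y U" "W = {x \<in> topspace X. f x \<in> U}"
    unfolding pulled_back_opens_def by blast
  have "W = {x \<in> topspace X. p x \<in> {z \<in> topspace Z. g z \<in> U}}"
    using U(2) f p by auto
  then show "W \<in> pulled_back_opens X Z p"
    using openin_continuous_map_preimage[OF g U(1)] unfolding pulled_back_opens_def by blast
qed

section \<open>From open factorizations to a spectrum\<close>

text \<open>Factorizability enters only through the step \<open>refine\<close>: every map to a second countable
  Tychonoff space is dominated by an open image. A diagonal map then gives upper bounds, and a
  real-valued function gives the base.\<close>
theorem openly_factorizable_imp_dense_in_open_omega_limit:
  fixes X :: "'a topology"
  assumes X: "tychonoff_space X" and fact: "openly_factorizable X"
  shows "dense_in_open_omega_limit X"
proof -
  define Q where "Q = (\<lambda>\<alpha> (Z :: (nat \<Rightarrow> real) topology) p. tychonoff_space Z \<and>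
      second_countable Z \<and> continuous_map X Z p \<and> open_map X Z p \<and>
      p ` topspace X = topspace Z \<and> \<alpha> = pulled_back_opens X Z p)"
  define A where "A = {\<alpha>. \<exists>Z p. Q \<alpha> Z p}"
  \<comment> \<open>Different open images may pull back the same family, so one representative is chosen for each.\<close>
  have "\<exists>Z p. Q \<alpha> Z p" if "\<alpha> \<in> A" for \<alpha>
    using that by (simp add: A_def)
  then obtain S p where SpQ: "\<And>\<alpha>. \<alpha> \<in> A \<Longrightarrow> Q \<alpha> (S \<alpha>) (p \<alpha>)"
    by metis
  note Sp = SpQ[unfolded Q_def]
  have refine: "\<exists>\<alpha>\<in>A. pulled_back_opens X Y f \<subseteq> \<alpha>"
    if Y: "tychonoff_space Y" "second_countable Y" and f: "continuous_map X Y f"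
    for Y :: "'y topology" and f
  proof -
    obtain Z :: "(nat \<Rightarrow> real) topology" and q g where q: "open_factorization X Y f Z q g"
      using openly_factorizableD[OF fact Y f] by blast
    then have "Q (pulled_back_opens X Z q) Z q"
      unfolding open_factorization_def Q_def by simp
    moreover have "pulled_back_opens X Y f \<subseteq> pulled_back_opens X Z q"
      using q unfolding open_factorization_def by (intro pulled_back_opens_factor[where g = g]) auto
    ultimately show ?thesis
      unfolding A_def by blast
  qed
  show ?thesis
  proof (rule dense_in_open_omega_limit_saturated[where A = A and S = S and p = p])
    show "Hausdorff_space X"
      using X by (simp add: tychonoff_space_def)
    fix C assume C: "C \<subseteq> A" "countable C"
    let ?P = "product_topology S C" and ?d = "\<lambda>x. \<lambda>c\<in>C. p c x"
    have SpC: "\<And>c. c \<in> C \<Longrightarrow> tychonoff_space (S c) \<and> second_countable (S c) \<and>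
        continuous_map X (S c) (p c)"
      and pC: "\<And>c. c \<in> C \<Longrightarrow> c = pulled_back_opens X (S c) (p c)"
      using C(1) Sp by blast+
    have d: "continuous_map X ?P ?d"
      unfolding continuous_map_componentwise
    proof (intro conjI ballI)
      show "?d ` topspace X \<subseteq> extensional C"
        by auto
      fix c assume c: "c \<in> C"
      show "continuous_map X (S c) (\<lambda>x. ?d x c)"
        using SpC[OF c] c by (simp add: continuous_map_eq[of X "S c" "p c"])
    qed
    have "tychonoff_space ?P" "second_countable ?P"
      using SpC tychonoff_space_product_topology[of C S]
        second_countable_product_topology[OF C(2), of S] by simp_all
    then obtain u where u: "u \<in> A" "pulled_back_opens X ?P ?d \<subseteq> u"
      using refine[OF _ _ d] by blast
    have "c \<subseteq> u" if c: "c \<in> C" for c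
    proof -
      have "pulled_back_opens X (S c) (p c) \<subseteq> pulled_back_opens X ?P ?d"
        by (rule pulled_back_opens_factor[OF continuous_map_product_projection[OF c]])
          (use c continuous_map_image_subset_topspace[OF d] in \<open>simp_all only: restrict_apply'\<close>)
      then show ?thesis
        using u(2) pC[OF c] by simp
    qed
    then show "\<exists>u\<in>A. \<forall>c\<in>C. c \<subseteq> u"
      using u(1) by blast
  next
    fix W x assume W: "openin X W" "x \<in> W"
    then obtain f where f: "continuous_map X euclideanreal f" "f x = 0" "f ` (topspace X - W) \<subseteq> {1}"
      using X unfolding tychonoff_space_def completely_regular_space_alt' by meson
    obtain \<alpha> where \<alpha>: "\<alpha> \<in> A" "pulled_back_opens X euclideanreal f \<subseteq> \<alpha>"
      using refine[OF second_countable_tychonoff_euclideanreal(2,1) f(1)] by blast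
    have "{x \<in> topspace X. f x \<in> {..<1}} \<in> pulled_back_opens X euclideanreal f"
      unfolding pulled_back_opens_def using open_lessThan[of "1::real"] by auto
    moreover have "x \<in> {x \<in> topspace X. f x \<in> {..<1}}"
      using W openin_subset f(2) by auto
    moreover have "{x \<in> topspace X. f x \<in> {..<1}} \<subseteq> W"
      using f(3) by fastforce
    ultimately show "\<exists>\<alpha>\<in>A. \<exists>V\<in>\<alpha>. x \<in> V \<and> V \<subseteq> W"
      using \<alpha> by (meson subsetD)
  next
    fix \<alpha> assume \<alpha>: "\<alpha> \<in> A"
    note t = Sp[OF \<alpha>, unfolded pulled_back_opens_def]
    show "tychonoff_space (S \<alpha>)" using t by (elim conjE)
    show "second_countable (S \<alpha>)" using t by (elim conjE)
    show "continuous_map X (S \<alpha>) (p \<alpha>)" using t by (elim conjE)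
    show "open_map X (S \<alpha>) (p \<alpha>)" using t by (elim conjE)
    show "p \<alpha> ` topspace X = topspace (S \<alpha>)" using t by (elim conjE)
    show "\<alpha> = {{x \<in> topspace X. p \<alpha> x \<in> U} | U. openin (S \<alpha>) U}" using t by (elim conjE)
  qed
qed

section \<open>From a spectrum to open factorizations\<close>

text \<open>A basic neighbourhood in the product restricts only finitely many coordinates. An index \<open>u\<close>
  above these determines them through the bonding maps, so on the limit a single coordinate is
  enough.\<close>
lemma limit_projections_base:
  assumes spec: "spectrum A r S \<pi>" and dir: "omega_directed_on A r"
    and G: "openin (spectrum_limit A r S \<pi>) G" "z \<in> G"
  obtains u V where "u \<in> A" "openin (S u) V" "z u \<in> V"
    "\<And>w. w \<in> topspace (spectrum_limit A r S \<pi>) \<Longrightarrow> w u \<in> V \<Longrightarrow> w \<in> G"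
proof -
  define L where "L = spectrum_limit A r S \<pi>"
  have topL: "topspace L =
      {z \<in> (\<Pi>\<^sub>E i\<in>A. topspace (S i)). \<forall>\<alpha> \<beta>. (\<alpha>, \<beta>) \<in> r \<longrightarrow> z \<alpha> = \<pi> \<alpha> \<beta> (z \<beta>)}"
    unfolding L_def spectrum_limit_def by auto
  obtain W where W: "openin (product_topology S A) W" "G = W \<inter> topspace L"
    using G(1) unfolding L_def by (blast elim: openin_spectrum_limit)
  obtain U where U: "finite {i \<in> A. U i \<noteq> topspace (S i)}" "\<And>i. i \<in> A \<Longrightarrow> openin (S i) (U i)"
      "z \<in> Pi\<^sub>E A U" "Pi\<^sub>E A U \<subseteq> W"
    using W G(2) unfolding openin_product_topology_alt by (metis IntD1)
  define F where "F = {i \<in> A. U i \<noteq> topspace (S i)}"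
  have F: "finite F" "F \<subseteq> A"
    using U(1) by (auto simp: F_def)
  then obtain u where u: "u \<in> A" "\<And>i. i \<in> F \<Longrightarrow> (i, u) \<in> r"
    using dir countable_finite unfolding omega_directed_on_def by metis
  define V where "V = topspace (S u) \<inter> \<Inter>((\<lambda>i. {s \<in> topspace (S u). \<pi> i u s \<in> U i}) ` F)"
  have V: "openin (S u) V"
  proof -
    have "openin (S u) {s \<in> topspace (S u). \<pi> i u s \<in> U i}" if "i \<in> F" for i
      using spec u(2)[OF that] U(2) F(2) that unfolding spectrum_def
      by (intro openin_continuous_map_preimage[of _ "S i"]) auto
    then show ?thesis
      unfolding V_def using F(1) by (intro openin_Int_Inter openin_topspace) auto
  qed
  have zL: "z \<in> topspace L"
    using W G(2) by blast
  have "\<pi> i u (z u) \<in> U i" if i: "i \<in> F" for i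
  proof -
    have "z i = \<pi> i u (z u)"
      using zL u(2)[OF i] by (simp add: topL)
    moreover have "z i \<in> U i"
      using U(3) F(2) i by (auto simp: PiE_iff)
    ultimately show ?thesis by simp
  qed
  then have "z u \<in> V"
    using zL u(1) by (auto simp: V_def topL PiE_iff)
  moreover have "w \<in> G" if w: "w \<in> topspace L" "w u \<in> V" for w
  proof -
    have "w i \<in> U i" if i: "i \<in> A" for i
    proof (cases "i \<in> F")
      case True
      then have "\<pi> i u (w u) \<in> U i" "w i = \<pi> i u (w u)"
        using w u(2) by (auto simp: V_def topL)
      then show ?thesis by simp
    next
      case False
      then show ?thesis
        using w(1) i by (auto simp: F_def topL)
    qed
    then have "w \<in> Pi\<^sub>E A U"
      using w(1) by (auto simp: topL PiE_iff)
    then show ?thesis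
      using U(4) W(2) w(1) by blast
  qed
  ultimately show thesis
    using that[OF u(1) V] unfolding L_def by blast
qed

text \<open>Weak Lindelofness supplies countably many pulled back sets that control \<open>f\<close> on a dense set
  only. Openness of the map \<open>p u\<close> extends this control to all of \<open>X\<close>, because two
  points of one fibre can be approximated by two points of a fibre inside one of the chosen sets.\<close>
lemma openly_factorizable_if_directed_open_images:
  fixes S :: "'i \<Rightarrow> 'z topology"
  assumes wL: "weakly_Lindelof_space X"
    and S: "\<And>\<alpha>. \<alpha> \<in> A \<Longrightarrow> tychonoff_space (S \<alpha>)" "\<And>\<alpha>. \<alpha> \<in> A \<Longrightarrow> second_countable (S \<alpha>)"
    and p: "\<And>\<alpha>. \<alpha> \<in> A \<Longrightarrow> continuous_map X (S \<alpha>) (p \<alpha>)" "\<And>\<alpha>. \<alpha> \<in> A \<Longrightarrow> open_map X (S \<alpha>) (p \<alpha>)"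
      "\<And>\<alpha>. \<alpha> \<in> A \<Longrightarrow> p \<alpha> ` topspace X = topspace (S \<alpha>)"
    and dir: "\<And>C. C \<subseteq> A \<Longrightarrow> countable C \<Longrightarrow>
      \<exists>u\<in>A. \<forall>c\<in>C. pulled_back_opens X (S c) (p c) \<subseteq> pulled_back_opens X (S u) (p u)"
    and base: "\<And>W x. openin X W \<Longrightarrow> x \<in> W \<Longrightarrow>
      \<exists>\<alpha>\<in>A. \<exists>V\<in>pulled_back_opens X (S \<alpha>) (p \<alpha>). x \<in> V \<and> V \<subseteq> W"
  shows "openly_factorizable X"
proof (rule openly_factorizableI)
  fix Y :: "(nat \<Rightarrow> real) topology" and f
  assume Y: "tychonoff_space Y" "second_countable Y" and f: "continuous_map X Y f"
  have fY: "f x \<in> topspace Y" if "x \<in> topspace X" for x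
    using f that continuous_map_image_subset_topspace by blast
  obtain \<B> where B: "countable \<B>" "\<forall>U\<in>\<B>. openin Y U"
    and sep: "\<forall>x\<in>topspace Y. \<forall>y\<in>topspace Y. x \<noteq> y \<longrightarrow>
      (\<exists>U\<in>\<B>. \<exists>V\<in>\<B>. x \<in> U \<and> y \<in> V \<and> Y closure_of U \<inter> Y closure_of V = {})"
    by (rule countable_base_separating_closures[OF Y(2,1)])
  define \<P> where "\<P> = {(U, V) \<in> \<B> \<times> \<B>. Y closure_of U \<inter> Y closure_of V = {}}"
  have "countable \<P>"
    using B(1) by (intro countable_subset[of \<P> "\<B> \<times> \<B>"]) (auto simp: \<P>_def)
  let ?O = "\<lambda>\<alpha>. pulled_back_opens X (S \<alpha>) (p \<alpha>)"
  have Oo: "openin X W" if "\<alpha> \<in> A" "W \<in> ?O \<alpha>" for \<alpha> W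
    using that openin_continuous_map_preimage[OF p(1)] unfolding pulled_back_opens_def by blast
  define controls where "controls Q \<V> \<longleftrightarrow> countable \<V> \<and> \<V> \<subseteq> (\<Union>\<alpha>\<in>A. ?O \<alpha>) \<and>
      X closure_of \<Union>\<V> = topspace X \<and> (\<forall>W\<in>\<V>. f ` W \<inter> fst Q = {} \<or> f ` W \<inter> snd Q = {})"
    for Q \<V>
  \<comment> \<open>A point \<open>f x\<close> cannot lie in both closures, and it has a neighbourhood missing the set whose
    closure avoids it.\<close>
  have "\<exists>\<V>. controls (U, V) \<V>" if UV: "(U, V) \<in> \<P>" for U V
  proof -
    define \<U> where "\<U> = {W \<in> (\<Union>\<alpha>\<in>A. ?O \<alpha>). f ` W \<inter> U = {} \<or> f ` W \<inter> V = {}}"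
    have "\<forall>W\<in>\<U>. openin X W"
      using Oo by (auto simp: \<U>_def)
    moreover have "\<Union>\<U> = topspace X"
    proof (intro equalityI subsetI)
      fix x assume "x \<in> \<Union>\<U>"
      then show "x \<in> topspace X"
        using Oo openin_subset by (fastforce simp: \<U>_def)
    next
      fix x assume x: "x \<in> topspace X"
      have "\<exists>T\<in>{U, V}. f x \<notin> Y closure_of T"
        using UV unfolding \<P>_def by blast
      then obtain T where T: "T \<in> {U, V}" "f x \<notin> Y closure_of T" ..
      let ?G = "{y \<in> topspace X. f y \<in> topspace Y - Y closure_of T}"
      have "openin Y (topspace Y - Y closure_of T)"
        by (simp add: openin_diff)
      then have "openin X ?G" "x \<in> ?G"
        using openin_continuous_map_preimage[OF f] x T(2) fY by blast+
      then obtain \<alpha> W where W: "\<alpha> \<in> A" "W \<in> ?O \<alpha>" "x \<in> W" "W \<subseteq> ?G"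
        using base by blast
      have "T \<subseteq> Y closure_of T"
        using T(1) UV B(2) openin_subset unfolding \<P>_def by (intro closure_of_subset) auto
      then have "f ` W \<inter> T = {}"
        using W(4) by blast
      then have "W \<in> \<U>"
        using T(1) W unfolding \<U>_def by auto
      then show "x \<in> \<Union>\<U>"
        using W(3) by blast
    qed
    ultimately obtain \<V> where "countable \<V>" "\<V> \<subseteq> \<U>" "X closure_of \<Union>\<V> = topspace X"
      using wL[unfolded weakly_Lindelof_space_def, rule_format, of \<U>]
      by blast
    then show ?thesis
      unfolding \<U>_def controls_def by (intro exI[of _ \<V>]) auto
  qed
  then have "\<exists>\<V>. controls Q \<V>" if "Q \<in> \<P>" for Q
    using that by (metis surj_pair)
  then obtain \<V> where controls: "\<And>Q. Q \<in> \<P> \<Longrightarrow> controls Q (\<V> Q)"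
    by metis
  have V: "\<And>Q. Q \<in> \<P> \<Longrightarrow> countable (\<V> Q)" "\<And>Q. Q \<in> \<P> \<Longrightarrow> \<V> Q \<subseteq> (\<Union>\<alpha>\<in>A. ?O \<alpha>)"
      "\<And>Q. Q \<in> \<P> \<Longrightarrow> X closure_of \<Union>(\<V> Q) = topspace X"
      "\<And>Q W. Q \<in> \<P> \<Longrightarrow> W \<in> \<V> Q \<Longrightarrow> f ` W \<inter> fst Q = {} \<or> f ` W \<inter> snd Q = {}"
    using controls unfolding controls_def by simp_all
  have "\<forall>W\<in>\<Union>(\<V> ` \<P>). \<exists>\<alpha>\<in>A. W \<in> ?O \<alpha>"
    using V(2) by blast
  then obtain ind where ind: "\<And>W. W \<in> \<Union>(\<V> ` \<P>) \<Longrightarrow> ind W \<in> A \<and> W \<in> ?O (ind W)"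
    by metis
  have "countable (ind ` \<Union>(\<V> ` \<P>))"
    using \<open>countable \<P>\<close> V(1) by blast
  then obtain u where u: "u \<in> A" "\<And>W. W \<in> \<Union>(\<V> ` \<P>) \<Longrightarrow> ?O (ind W) \<subseteq> ?O u"
    using dir[of "ind ` \<Union>(\<V> ` \<P>)"] ind by blast
  have sat: "W \<in> ?O u" if "Q \<in> \<P>" "W \<in> \<V> Q" for Q W
    using u(2) ind that by blast
  have fibres: "f x = f y" if xy: "x \<in> topspace X" "y \<in> topspace X" "p u x = p u y" for x y
  proof (rule ccontr)
    assume "f x \<noteq> f y"
    then obtain U V where UV: "(U, V) \<in> \<P>" "f x \<in> U" "f y \<in> V"
      using sep[rule_format, OF fY[OF xy(1)] fY[OF xy(2)]] unfolding \<P>_def by auto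
    define M where "M = (\<lambda>T. {z \<in> topspace X. f z \<in> T})"
    have M: "openin X (M U)" "openin X (M V)"
      using UV(1) B(2) openin_continuous_map_preimage[OF f] unfolding \<P>_def M_def by blast+
    \<comment> \<open>The fibres over \<open>G\<close> are those that meet both preimages; openness of \<open>p u\<close> makes \<open>G\<close> open,
      so a chosen set \<open>W\<close> reaches one of these fibres and, being pulled back, contains it.\<close>
    define G where "G = p u ` M U \<inter> p u ` M V"
    have G: "openin (S u) G"
      unfolding G_def using p(2)[OF u(1)] M by (auto simp: open_map_def)
    have "x \<in> M U" "y \<in> M V"
      using xy(1,2) UV(2,3) by (simp_all add: M_def)
    then have "p u x \<in> G"
      unfolding G_def using imageI[of x "M U" "p u"] imageI[of y "M V" "p u"] xy(3) by simp
    then have "x \<in> {z \<in> topspace X. p u z \<in> G}"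
      using xy(1) by simp
    moreover have "openin X {z \<in> topspace X. p u z \<in> G}"
      using openin_continuous_map_preimage[OF p(1)[OF u(1)] G] .
    ultimately obtain W z where W: "W \<in> \<V> (U, V)" "z \<in> W" "z \<in> topspace X" "p u z \<in> G"
      using V(3)[OF UV(1), unfolded dense_intersects_open, rule_format,
          of "{z \<in> topspace X. p u z \<in> G}"] by blast
    obtain x' y' where x': "x' \<in> M U" "p u x' = p u z" and y': "y' \<in> M V" "p u y' = p u z"
      using W(4) by (auto simp: G_def)
    obtain T where "W = {z \<in> topspace X. p u z \<in> T}"
      using sat[OF UV(1) W(1)] unfolding pulled_back_opens_def by blast
    then have "x' \<in> W" "y' \<in> W"
      using W(2) x' y' by (auto simp: M_def)
    then show False
      using V(4)[OF UV(1) W(1)] x' y' by (auto simp: M_def)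
  qed
  have "quotient_map X (S u) (p u)"
    by (rule continuous_open_imp_quotient_map) (rule p u(1))+
  then obtain g where "continuous_map (S u) Y g" "\<And>x. x \<in> topspace X \<Longrightarrow> g (p u x) = f x"
    using quotient_map_lift_exists[OF _ f] fibres by metis
  then show "\<exists>(Z :: 'z topology) q g. open_factorization X Y f Z q g"
    unfolding open_factorization_def
    by (intro exI[of _ "S u"] exI[of _ "p u"] exI[of _ g]) (simp add: S p u(1))
qed

text \<open>The maps \<open>p \<alpha>\<close> are the limit projections read on \<open>X\<close> through the embedding. Bonding maps give
  directedness, and the single-coordinate base of the limit restricts to a base of \<open>X\<close>.\<close>
theorem weakly_Lindelof_dense_in_open_omega_limit_imp_openly_factorizable:
  fixes X :: "'a topology"
  assumes wL: "weakly_Lindelof_space X" and lim: "dense_in_open_omega_limit X"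
  shows "openly_factorizable X"
proof -
  obtain A :: "'a set set set" and r and S :: "'a set set \<Rightarrow> (nat \<Rightarrow> real) topology" and \<pi> D
    where pres: "spectral_presentation X A r S \<pi> D"
    using lim unfolding dense_in_open_omega_limit_def by blast
  define L where "L = spectrum_limit A r S \<pi>"
  have os: "omega_spectrum A r S \<pi>" and DL: "D \<subseteq> topspace L"
    and hs: "X homeomorphic_space subtopology L D"
    and projo: "\<And>\<alpha>. \<alpha> \<in> A \<Longrightarrow> open_map (subtopology L D) (S \<alpha>) (\<lambda>x. x \<alpha>)"
    and projs: "\<And>\<alpha>. \<alpha> \<in> A \<Longrightarrow> (\<lambda>x. x \<alpha>) ` D = topspace (S \<alpha>)"
    using pres unfolding spectral_presentation_def L_def by blast+
  have spec: "spectrum A r S \<pi>" and od: "omega_directed_on A r"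
    and Ssc: "\<And>\<alpha>. \<alpha> \<in> A \<Longrightarrow> second_countable (S \<alpha>)"
    using os unfolding omega_spectrum_def by blast+
  have Sty: "\<And>\<alpha>. \<alpha> \<in> A \<Longrightarrow> tychonoff_space (S \<alpha>)"
    and pic: "\<And>\<alpha> \<beta>. (\<alpha>, \<beta>) \<in> r \<Longrightarrow> continuous_map (S \<beta>) (S \<alpha>) (\<pi> \<alpha> \<beta>)"
    using spec unfolding spectrum_def by blast+
  obtain h where h: "homeomorphic_map X (subtopology L D) h"
    using hs homeomorphic_space by blast
  have topD: "topspace (subtopology L D) = D"
    using DL by auto
  have hc: "continuous_map X (subtopology L D) h" and ho: "open_map X (subtopology L D) h"
    and hD: "h ` topspace X = D" and hi: "inj_on h (topspace X)"
    using h topD homeomorphic_imp_continuous_map homeomorphic_imp_open_map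
      homeomorphic_imp_surjective_map[OF h] homeomorphic_imp_injective_map by auto
  define p where "p = (\<lambda>\<alpha> x. h x \<alpha>)"
  have pc: "continuous_map X (S \<alpha>) (p \<alpha>)" if "\<alpha> \<in> A" for \<alpha>
  proof -
    have "continuous_map (subtopology L D) (S \<alpha>) (\<lambda>z. z \<alpha>)"
      unfolding L_def spectrum_limit_def
      by (intro continuous_map_from_subtopology continuous_map_product_projection that)
    from continuous_map_compose[OF hc this] show ?thesis
      by (simp add: p_def comp_def)
  qed
  have po: "open_map X (S \<alpha>) (p \<alpha>)" if "\<alpha> \<in> A" for \<alpha>
    using open_map_compose[OF ho projo[OF that]] by (simp add: p_def comp_def)
  have ps: "p \<alpha> ` topspace X = topspace (S \<alpha>)" if "\<alpha> \<in> A" for \<alpha>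
    using projs[OF that] unfolding p_def hD[symmetric] image_image .
  show ?thesis
  proof (rule openly_factorizable_if_directed_open_images[OF wL Sty Ssc pc po ps])
    fix C assume C: "C \<subseteq> A" "countable C"
    then obtain u where u: "u \<in> A" "\<forall>c\<in>C. (c, u) \<in> r"
      using od unfolding omega_directed_on_def by blast
    have "pulled_back_opens X (S c) (p c) \<subseteq> pulled_back_opens X (S u) (p u)" if "c \<in> C" for c
    proof (rule pulled_back_opens_factor[OF pic])
      show "(c, u) \<in> r"
        using u(2) that by blast
      fix x assume "x \<in> topspace X"
      then have "h x \<in> topspace L"
        using hD DL by blast
      then show "p c x = \<pi> c u (p u x)"
        using u(2) that by (auto simp: p_def L_def spectrum_limit_def)
    qed (use ps u(1) in simp)
    then show "\<exists>u\<in>A. \<forall>c\<in>C. pulled_back_opens X (S c) (p c) \<subseteq> pulled_back_opens X (S u) (p u)"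
      using u(1) by blast
  next
    fix W x assume W: "openin X W" "x \<in> W"
    have "openin (subtopology L D) (h ` W)"
      using ho W(1) by (simp add: open_map_def)
    then obtain G where G: "openin L G" "h ` W = G \<inter> D"
      unfolding openin_subtopology by blast
    obtain u V where u: "u \<in> A" and V: "openin (S u) V" "h x u \<in> V"
        "\<And>w. w \<in> topspace L \<Longrightarrow> w u \<in> V \<Longrightarrow> w \<in> G"
      using limit_projections_base[OF spec od, of G "h x"] G W(2) unfolding L_def by blast
    let ?V = "{y \<in> topspace X. p u y \<in> V}"
    have WX: "W \<subseteq> topspace X"
      using openin_subset[OF W(1)] .
    have "y \<in> W" if y: "y \<in> ?V" for y
    proof -
      have "h y \<in> D" "h y \<in> G"
        using y hD DL V(3)[of "h y"] by (auto simp: p_def)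
      then have "h y \<in> h ` W"
        using G(2) by blast
      then show ?thesis
        using inj_on_image_mem_iff[OF hi _ WX] y by blast
    qed
    moreover have "x \<in> ?V" "?V \<in> pulled_back_opens X (S u) (p u)"
      using W(2) WX V by (auto simp: p_def pulled_back_opens_def)
    ultimately show "\<exists>\<alpha>\<in>A. \<exists>V\<in>pulled_back_opens X (S \<alpha>) (p \<alpha>). x \<in> V \<and> V \<subseteq> W"
      using u by (intro bexI[of _ u] bexI[of _ ?V]) auto
  qed
qed

theorem theorem3p2:
  fixes X :: "'a topology"
  assumes "tychonoff_space X"
  shows "(openly_factorizable X \<longrightarrow> dense_in_open_omega_limit X) \<and>
         (weakly_Lindelof_space X \<longrightarrow>
            (openly_factorizable X \<longleftrightarrow> dense_in_open_omega_limit X))"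
  using openly_factorizable_imp_dense_in_open_omega_limit[OF assms]
    weakly_Lindelof_dense_in_open_omega_limit_imp_openly_factorizable by blast

end
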